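(* Let $E$ be a nonzero real Banach space, let $T : E^* \rightrightarrows E^{**}$ be a multifunction with $R(T) \subset \widehat{E}$, and define $S : E \rightrightarrows E^*$ by $G(S) = L^{-1}G(T)$, that is, $x^* \in Sx \iff \widehat{x} \in T x^*$. Then: (a) $G(T) \subset L\big(G(S)\big)$. (b) Suppose in addition that $T$ is maximally monotone. Then $S$ is maximally monotone. (c) Suppose in addition that $T$ is maximally monotone and $D(T) = E^*$. Then $S$ is maximally monotone and quasidense, and $S^{\mathbb F} = T$.
   Context: $\widehat{x}$ is the canonical image of $x \in E$ in $E^{**}$ and $\widehat{E} := \{\widehat{x} : x \in E\}$. $L : E \times E^* \to E^* \times E^{**}$ is $L(x,x^* ) := (x^*,\widehat{x})$. For a multifunction $U$, $G(U)$ is its graph, $D(U)$ the set of points where its value is nonempty, and $R(U)$ the union of its values. A multifunction $E \rightrightarrows E^*$ (resp. $E^* \rightrightarrows E^{**}$) is (maximally) monotone if its graph is a (maximally) monotone subset of $E \times E^*$ (resp. of $E^* \times E^{**}$ under the pairing $\langle y^*, y^{**}\rangle$). $S$ is quasidense if, for all $(x,x^* ) \in E \times E^*$, $\inf_{(s,s^* ) \in G(S)}\big[\frac12\|s-x\|^2 + \frac12\|s^*-x^*\|^2 + \langle s-x, s^*-x^*\rangle\big] \le 0$. For a closed (i.e. with norm-closed graph), quasidense, monotone $S : E \rightrightarrows E^*$, let $\varphi_S(x,x^* ) := \sup_{(s,s^* ) \in G(S)}[\langle s, x^*\rangle + \langle x, s^*\rangle - \langle s, s^*\rangle]$ and ${\varphi_S}^*(y^*,y^{**})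 := \sup_{(x,x^* ) \in E \times E^*}[\langle x, y^*\rangle + \langle x^*, y^{**}\rangle - \varphi_S(x,x^* )]$; the Fitzpatrick extension $S^{\mathbb F} : E^* \rightrightarrows E^{**}$ is the multifunction with graph $G(S^{\mathbb F}) := \{(y^*,y^{**}) \in E^* \times E^{**} : {\varphi_S}^*(y^*,y^{**}) = \langle y^*, y^{**}\rangle\}$. *)

theory Defs
  imports "HOL-Analysis.Analysis"
begin

text \<open>
  The dual of a real normed space \<open>'a\<close> is the type \<open>'a \<Rightarrow>\<^sub>L real\<close> of bounded linear
  functionals with the operator norm, and the bidual is its dual again. A multifunction
  is a set-valued function. Every notion below is stated for an arbitrary normed space, so a
  multifunction from the dual to the bidual is covered by the instance \<open>'a := 'b \<Rightarrow>\<^sub>L real\<close>.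
\<close>

type_synonym 'a dual = "'a \<Rightarrow>\<^sub>L real"
type_synonym 'a bidual = "('a \<Rightarrow>\<^sub>L real) \<Rightarrow>\<^sub>L real"

definition canon :: "'a::real_normed_vector \<Rightarrow> 'a bidual" where
  "canon x = Blinfun (\<lambda>f. blinfun_apply f x)"

text \<open>\<^const>\<open>Blinfun\<close> is meaningful only on bounded linear maps; this holds here.\<close>

lemma blinfun_apply_canon [simp]: "blinfun_apply (canon x) f = blinfun_apply f x"
  unfolding canon_def
  by (simp add: bounded_linear_Blinfun_apply blinfun.bounded_linear_left)

definition L_map :: "'a::real_normed_vector \<times> 'a dual \<Rightarrow> 'a dual \<times> 'a bidual" where
  "L_map = (\<lambda>(x, x'). (x', canon x))"

definition mf_graph :: "('a \<Rightarrow> 'b set) \<Rightarrow> ('a \<times> 'b) set" where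
  "mf_graph U = {(x, y). y \<in> U x}"

definition mf_domain :: "('a \<Rightarrow> 'b set) \<Rightarrow> 'a set" where
  "mf_domain U = {x. U x \<noteq> {}}"

definition mf_range :: "('a \<Rightarrow> 'b set) \<Rightarrow> 'b set" where
  "mf_range U = (\<Union>x. U x)"

definition monotone_set :: "('a::real_normed_vector \<times> 'a dual) set \<Rightarrow> bool" where
  "monotone_set A \<longleftrightarrow>
     (\<forall>(s, s') \<in> A. \<forall>(t, t') \<in> A. 0 \<le> blinfun_apply (s' - t') (s - t))"

definition maximally_monotone_set :: "('a::real_normed_vector \<times> 'a dual) set \<Rightarrow> bool" where
  "maximally_monotone_set A \<longleftrightarrow>
     monotone_set A \<and> (\<forall>B. monotone_set B \<and> A \<subseteq> B \<longrightarrow> B = A)"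

definition maximally_monotone :: "('a::real_normed_vector \<Rightarrow> 'a dual set) \<Rightarrow> bool" where
  "maximally_monotone U \<longleftrightarrow> maximally_monotone_set (mf_graph U)"

text \<open>
  Infima and suprema are taken in the extended reals, so that they are correct for
  unbounded and for empty index sets.
\<close>

definition quasidense :: "('a::real_normed_vector \<Rightarrow> 'a dual set) \<Rightarrow> bool" where
  "quasidense S \<longleftrightarrow>
     (\<forall>x x'. (INF (s, s') \<in> mf_graph S.
        ereal ((norm (s - x))\<^sup>2 / 2 + (norm (s' - x'))\<^sup>2 / 2
               + blinfun_apply (s' - x') (s - x))) \<le> 0)"

definition fitzpatrick :: "('a::real_normed_vector \<Rightarrow> 'a dual set) \<Rightarrow> 'a \<times> 'a dual \<Rightarrow> ereal" where
  "fitzpatrick S = (\<lambda>(x, x').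
     (SUP (s, s') \<in> mf_graph S.
        ereal (blinfun_apply x' s + blinfun_apply s' x - blinfun_apply s' s)))"

definition fitzpatrick_conj ::
  "('a::real_normed_vector \<Rightarrow> 'a dual set) \<Rightarrow> 'a dual \<times> 'a bidual \<Rightarrow> ereal" where
  "fitzpatrick_conj S = (\<lambda>(y', y'').
     (SUP (x, x') \<in> UNIV.
        ereal (blinfun_apply y' x + blinfun_apply y'' x') - fitzpatrick S (x, x')))"

text \<open>
  The Fitzpatrick extension is intended for closed, quasidense, monotone \<open>S\<close> only; the formula
  is total. A maximally monotone \<open>S\<close> automatically has a norm-closed graph.
\<close>

definition fitzpatrick_ext ::
  "('a::real_normed_vector \<Rightarrow> 'a dual set) \<Rightarrow> 'a dual \<Rightarrow> 'a bidual set" where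
  "fitzpatrick_ext S y' = {y''. fitzpatrick_conj S (y', y'') = ereal (blinfun_apply y'' y')}"

end

theory Submission
  imports Defs
begin

text \<open>
  The map \<open>L\<close> preserves the pairing of differences, and the inclusion of \<open>R(T)\<close> in the canonical image of \<open>E\<close> puts the
  graph of \<open>T\<close> inside the range of \<open>L\<close>. Hence \<open>G(T) = L(G(S))\<close>, and a pair is monotonically
  related to \<open>G(S)\<close> exactly if its image is monotonically related to \<open>G(T)\<close>. This gives (a)
  and (b).

  For (c), \<open>D(T) = E\<^sup>*\<close> means that \<open>S\<close> is surjective, and every surjective maximally monotone
  \<open>S\<close> on a Banach space is quasidense. Write \<open>q(x, x') = \<langle>x, x'\<rangle>\<close>, and let the
  \<open>\<epsilon>\<close>-enlargement of \<open>G(S)\<close> consist of the \<open>b\<close> with \<open>q(b - a) \<ge> - \<epsilon>\<close> for all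
  \<open>a \<in> G(S)\<close>; this is the set where the Fitzpatrick function exceeds \<open>q\<close> by at most \<open>\<epsilon>\<close>,
  so that no values in the extended reals are needed. The proof has two steps.

  First, for every \<open>c\<close> and \<open>\<epsilon> > 0\<close> some \<open>b\<close> in the \<open>\<epsilon>\<close>-enlargement satisfies
  \<open>\<parallel>b - c\<parallel>\<^sup>2 / 2 + q(b - c) < \<epsilon>\<close> (lemma \<open>enlargement_approximation\<close>). Otherwise Fenchel duality
  provides a functional \<open>(y', y'')\<close> on \<open>E \<times> E\<^sup>*\<close> that separates the Fitzpatrick function from
  \<open>- \<parallel>\<cdot>\<parallel>\<^sup>2 / 2\<close> strictly, and evaluating it at a point of the graph whose second coordinate is
  prescribed by \<open>y'\<close>, which exists by surjectivity, contradicts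
  \<open>- \<langle>y', y''\<rangle> \<le> \<parallel>(y', y'')\<parallel>\<^sup>2 / 2\<close>.

  Second, points of the \<open>\<epsilon>\<close>-enlargement are close to the graph (lemma
  \<open>enlargement_near_graph\<close>): take the first step repeatedly, with the previous point as new centre
  and with errors that decrease geometrically. By convexity of the Fitzpatrick function, \<open>- q\<close> of
  the difference of two points of small enlargements has a small upper bound, so the steps
  are summable; the limit exists by completeness, is monotonically related to the graph, and
  lies in the graph by maximality.

  Finally, \<open>S\<^sup>F = T\<close> is a direct computation. On \<open>L(G(S))\<close> the conjugate of the Fitzpatrick
  function equals the pairing. Conversely, if the conjugate at \<open>(y', y'')\<close> equals
  \<open>\<langle>y', y''\<rangle>\<close>, then the values of its defining supremum at points of \<open>G(S)\<close> say that
  \<open>(y', y'')\<close> is monotonically related to \<open>L(G(S)) = G(T)\<close>, and maximality of \<open>T\<close> applies.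
\<close>

section \<open>Linear minorants of convex functions\<close>

text \<open>
  A form of the Hahn-Banach theorem. Among the convex functions below \<open>h\<close> that vanish at \<open>0\<close>, Zorn's
  lemma yields a minimal one, \<open>f\<close>. The functions \<open>f (t x) / t\<close> with \<open>0 < t \<le> 1\<close> are again convex,
  vanish at \<open>0\<close> and lie below \<open>f\<close>, so they equal \<open>f\<close>, which makes \<open>f\<close> positively homogeneous
  and hence subadditive. Then \<open>f (x + a) - f a\<close> also lies below \<open>f\<close>, so it equals \<open>f\<close>, which
  makes \<open>f\<close> additive.
\<close>

lemma convex_function_dominates_linear:
  fixes h :: "'v::real_vector \<Rightarrow> real"
  assumes convex_h: "convex_on UNIV h" and h0: "h 0 = 0"
  shows "\<exists>f. linear f \<and> (\<forall>x. f x \<le> h x)"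
proof -
  define A where "A = {f. convex_on UNIV f \<and> f 0 = 0 \<and> (\<forall>x. f x \<le> h x)}"
  let ?below = "\<lambda>f g. \<forall>x. g x \<le> f x"
  \<comment> \<open>Midpoint convexity at \<open>0\<close> bounds the functions of \<open>A\<close> from below by a common function,
    so infima of chains are finite.\<close>
  have lower: "- h (- x) \<le> f x" if "f \<in> A" for f x
  proof -
    have "f ((1 - 1/2) *\<^sub>R x + (1/2) *\<^sub>R (- x)) \<le> (1 - 1/2) * f x + (1/2) * f (- x)"
      using that by (intro convex_onD[of UNIV]) (auto simp: A_def)
    moreover have "f (- x) \<le> h (- x)" "f 0 = 0" using that by (auto simp: A_def)
    ultimately show ?thesis by (simp add: algebra_simps)
  qed
  have "\<exists>m\<in>A. \<forall>a\<in>A. ?below m a \<longrightarrow> a = m"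
  proof (rule predicate_Zorn)
    show "partial_order_on A (relation_of ?below A)"
      by (rule partial_order_on_relation_ofI) (blast intro: order_trans order_antisym ext)+
  next
    fix C assume C: "C \<in> Chains (relation_of ?below A)"
    then have CA: "C \<subseteq> A" and total: "\<And>f g. f \<in> C \<Longrightarrow> g \<in> C \<Longrightarrow> ?below f g \<or> ?below g f"
      by (auto simp: Chains_def relation_of_def)
    \<comment> \<open>The pointwise infimum of a chain is a bound for it.\<close>
    show "\<exists>u\<in>A. \<forall>a\<in>C. ?below a u"
    proof (cases "C = {}")
      case True
      then show ?thesis using assms by (auto simp: A_def)
    next
      case False
      define u where "u x = (INF f\<in>C. f x)" for x
      have bdd: "bdd_below ((\<lambda>f. f x) ` C)" for x
        using lower CA by (auto intro!: bdd_belowI[of _ "- h (- x)"])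
      have u_le: "u x \<le> f x" if "f \<in> C" for f x
        unfolding u_def using bdd that by (rule cINF_lower)
      have approx: "\<exists>f\<in>C. f x < u x + e" if "e > 0" for x e
        using cINF_less_iff[OF False bdd, of x "u x + e"] that by (simp add: u_def)
      have "convex_on UNIV u"
      proof (rule convex_onI)
        fix t x y assume t: "0 < (t::real)" "t < 1"
        show "u ((1 - t) *\<^sub>R x + t *\<^sub>R y) \<le> (1 - t) * u x + t * u y"
        proof (rule field_le_epsilon)
          fix e :: real assume "e > 0"
          then obtain f g where fg: "f \<in> C" "f x < u x + e" "g \<in> C" "g y < u y + e"
            using approx by blast
          obtain k where k: "k \<in> C" "k x \<le> f x" "k y \<le> g y"
            using total[of f g] fg by auto
          have "u ((1 - t) *\<^sub>R x + t *\<^sub>R y) \<le> k ((1 - t) *\<^sub>R x + t *\<^sub>R y)"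
            by (rule u_le[OF k(1)])
          also have "\<dots> \<le> (1 - t) * k x + t * k y"
            using k(1) CA t by (intro convex_onD[of UNIV]) (auto simp: A_def)
          also have "\<dots> \<le> (1 - t) * (u x + e) + t * (u y + e)"
            using k fg t by (intro add_mono mult_left_mono) auto
          finally show "u ((1 - t) *\<^sub>R x + t *\<^sub>R y) \<le> (1 - t) * u x + t * u y + e"
            by (simp add: algebra_simps)
        qed
      qed simp
      moreover have "u 0 = 0"
      proof -
        have "(\<lambda>f. f 0) ` C = (\<lambda>_. 0) ` C"
          using CA by (intro image_cong) (auto simp: A_def)
        then show ?thesis using False by (simp add: u_def image_constant_conv)
      qed
      moreover have "u x \<le> h x" for x
        using False CA u_le[of _ x] by (force simp: A_def intro: order_trans)
      ultimately show ?thesis using u_le by (auto simp: A_def)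
    qed
  qed
  then obtain f where fA: "f \<in> A" and minimal: "\<And>g. g \<in> A \<Longrightarrow> (\<And>x. g x \<le> f x) \<Longrightarrow> g = f"
    by blast
  have cf: "convex_on UNIV f" and f0: "f 0 = 0" and fh: "\<And>x. f x \<le> h x"
    using fA by (auto simp: A_def)
  have minimal': "g = f" if "convex_on UNIV g" "g 0 = 0" "\<And>x. g x \<le> f x" for g
    using minimal[of g] that fh by (force simp: A_def intro: order_trans)
  have small: "f (t *\<^sub>R x) = t * f x" if t: "0 < t" "t \<le> 1" for t x
  proof -
    have "(\<lambda>x. f (t *\<^sub>R x) / t) = f"
    proof (rule minimal')
      show "convex_on UNIV (\<lambda>x. f (t *\<^sub>R x) / t)"
      proof (rule convex_onI)
        fix s x y assume s: "0 < (s::real)" "s < 1"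
        have "f ((1 - s) *\<^sub>R (t *\<^sub>R x) + s *\<^sub>R (t *\<^sub>R y)) \<le> (1 - s) * f (t *\<^sub>R x) + s * f (t *\<^sub>R y)"
          using s by (intro convex_onD[OF cf]) auto
        then show "f (t *\<^sub>R ((1 - s) *\<^sub>R x + s *\<^sub>R y)) / t
            \<le> (1 - s) * (f (t *\<^sub>R x) / t) + s * (f (t *\<^sub>R y) / t)"
          using t by (simp add: field_simps scaleR_add_right)
      qed simp
      show "f (t *\<^sub>R x) / t \<le> f x" for x
        using convex_onD[OF cf, of t 0 x] t f0 by (simp add: field_simps)
    qed (simp add: f0)
    then have "f (t *\<^sub>R x) / t = f x" by (rule fun_cong)
    then show ?thesis using t by (simp add: field_simps)
  qed
  have subadd: "f (x + a) \<le> f x + f a" for x a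
    using convex_onD[OF cf, of "1/2" x a] small[of "1/2" "x + a"]
    by (simp add: scaleR_add_right)
  have add: "f (x + a) = f x + f a" for x a
  proof -
    have "(\<lambda>x. f (x + a) - f a) = f"
    proof (rule minimal')
      show "convex_on UNIV (\<lambda>x. f (x + a) - f a)"
      proof (rule convex_onI)
        fix s x y assume s: "0 < (s::real)" "s < 1"
        have "(1 - s) *\<^sub>R x + s *\<^sub>R y + a = (1 - s) *\<^sub>R (x + a) + s *\<^sub>R (y + a)"
          by (simp add: algebra_simps)
        then have "f ((1 - s) *\<^sub>R x + s *\<^sub>R y + a) \<le> (1 - s) * f (x + a) + s * f (y + a)"
          using s convex_onD[OF cf, of s "x + a" "y + a"] by simp
        then show "f ((1 - s) *\<^sub>R x + s *\<^sub>R y + a) - f a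
            \<le> (1 - s) * (f (x + a) - f a) + s * (f (y + a) - f a)"
          by (simp add: algebra_simps)
      qed simp
    qed (use subadd f0 in \<open>auto simp: algebra_simps\<close>)
    from fun_cong[OF this, of x] show ?thesis by simp
  qed
  have pos: "f (t *\<^sub>R x) = t * f x" if "t > 0" for t x
  proof (cases "t \<le> 1")
    case False
    then show ?thesis using small[of "1/t" "t *\<^sub>R x"] by (simp add: field_simps)
  qed (use small that in simp)
  have "f (t *\<^sub>R x) = t * f x" for t x
  proof -
    consider "t > 0" | "t = 0" | "t < 0" by linarith
    then show ?thesis
    proof cases
      case 3
      have "f (t *\<^sub>R x) + f ((- t) *\<^sub>R x) = 0" using add[of "t *\<^sub>R x" "(- t) *\<^sub>R x"] f0 by simp
      then show ?thesis using pos[of "- t" x] 3 by simp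
    qed (simp_all add: pos f0)
  qed
  then have "linear f" using add by (intro linearI) auto
  then show ?thesis using fh by blast
qed

section \<open>Fenchel duality with half the squared norm\<close>

lemma half_square_norm_convex:
  fixes a b :: "'v::real_normed_vector"
  assumes "0 \<le> t" "t \<le> 1"
  shows "(norm ((1 - t) *\<^sub>R a + t *\<^sub>R b))\<^sup>2 / 2 \<le> (1 - t) * ((norm a)\<^sup>2 / 2) + t * ((norm b)\<^sup>2 / 2)"
proof -
  have "norm ((1 - t) *\<^sub>R a + t *\<^sub>R b) \<le> (1 - t) * norm a + t * norm b"
    using norm_triangle_ineq[of "(1 - t) *\<^sub>R a" "t *\<^sub>R b"] assms by simp
  then have "(norm ((1 - t) *\<^sub>R a + t *\<^sub>R b))\<^sup>2 \<le> ((1 - t) * norm a + t * norm b)\<^sup>2"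
    by (simp add: power_mono)
  also have "\<dots> = (1 - t) * (norm a)\<^sup>2 + t * (norm b)\<^sup>2 - t * (1 - t) * (norm a - norm b)\<^sup>2"
    by (simp add: power2_eq_square algebra_simps)
  also have "\<dots> \<le> (1 - t) * (norm a)\<^sup>2 + t * (norm b)\<^sup>2"
    using assms by simp
  finally show ?thesis by simp
qed

text \<open>
  \<open>C\<close> plays the part of the epigraph of a convex function \<open>\<phi>\<close> with \<open>\<phi> + \<parallel>\<cdot>\<parallel>\<^sup>2 / 2 \<ge> e\<close>. The
  functional \<open>y\<close> is a subgradient at \<open>0\<close> of the infimal convolution \<open>h d = inf (\<phi> u + \<parallel>u - d\<parallel>\<^sup>2 / 2)\<close>,
  which is convex, finite everywhere, and bounded above near \<open>0\<close>; the last property makes \<open>y\<close>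
  bounded.
\<close>

lemma fenchel_duality_half_square_norm:
  fixes C :: "('v::real_normed_vector \<times> real) set"
  assumes "convex C" "C \<noteq> {}" and lower: "\<And>u r. (u, r) \<in> C \<Longrightarrow> e \<le> r + (norm u)\<^sup>2 / 2"
  obtains y where "bounded_linear y"
    "\<And>u r c. (u, r) \<in> C \<Longrightarrow> e + y u - y c \<le> r + (norm c)\<^sup>2 / 2"
proof -
  define k where "k d p = snd p + (norm (fst p - d))\<^sup>2 / 2" for d and p :: "'v \<times> real"
  define h where "h d = (INF p\<in>C. k d p)" for d
  have k_convex: "k ((1 - t) *\<^sub>R d + t *\<^sub>R d') ((1 - t) *\<^sub>R p + t *\<^sub>R p') \<le> (1 - t) * k d p + t * k d' p'"
    if "0 \<le> t" "t \<le> 1" for t d d' p p'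
  proof -
    have "fst ((1 - t) *\<^sub>R p + t *\<^sub>R p') - ((1 - t) *\<^sub>R d + t *\<^sub>R d')
        = (1 - t) *\<^sub>R (fst p - d) + t *\<^sub>R (fst p' - d')"
      by (simp add: algebra_simps)
    then show ?thesis
      using half_square_norm_convex[OF that, of "fst p - d" "fst p' - d'"]
      by (simp add: k_def algebra_simps)
  qed
  have mix: "(1 - t) *\<^sub>R p + t *\<^sub>R p' \<in> C" if "p \<in> C" "p' \<in> C" "0 \<le> t" "t \<le> 1" for t p p'
    using convexD_alt[OF \<open>convex C\<close> that] .
  have k0: "e \<le> k 0 p" if "p \<in> C" for p
    using lower[of "fst p" "snd p"] that by (simp add: k_def)
  obtain p0 where p0: "p0 \<in> C" using \<open>C \<noteq> {}\<close> by blast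
  \<comment> \<open>Since \<open>0\<close> is the midpoint of \<open>d\<close> and \<open>- d\<close>, the bound at \<open>0\<close> and the value at \<open>- d\<close>
    for one fixed \<open>p0\<close> together bound \<open>k d\<close> from below.\<close>
  have k_lower: "2 * e - k (- d) p0 \<le> k d p" if "p \<in> C" for d p
  proof -
    have "k ((1 - 1/2) *\<^sub>R d + (1/2) *\<^sub>R (- d)) ((1 - 1/2) *\<^sub>R p + (1/2) *\<^sub>R p0)
        \<le> (1 - 1/2) * k d p + (1/2) * k (- d) p0"
      by (rule k_convex) auto
    moreover have "(1 - 1/2) *\<^sub>R d + (1/2) *\<^sub>R (- d) = 0" by simp
    ultimately show ?thesis using k0[OF mix[OF that p0, of "1/2"]] by simp
  qed
  have bdd: "bdd_below (k d ` C)" for d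
    using k_lower by (auto intro!: bdd_belowI[of _ "2 * e - k (- d) p0"])
  have h_le: "h d \<le> k d p" if "p \<in> C" for d p
    unfolding h_def using bdd that by (rule cINF_lower)
  have approx: "\<exists>p\<in>C. k d p < h d + \<delta>" if "\<delta> > 0" for d \<delta>
    using cINF_less_iff[OF \<open>C \<noteq> {}\<close> bdd, of d "h d + \<delta>"] that by (simp add: h_def)
  have h0: "e \<le> h 0"
    unfolding h_def using \<open>C \<noteq> {}\<close> k0 by (intro cINF_greatest) auto
  have "convex_on UNIV (\<lambda>d. h d - h 0)"
  proof (rule convex_onI)
    fix t and x y :: 'v assume t: "0 < (t::real)" "t < 1"
    have "h ((1 - t) *\<^sub>R x + t *\<^sub>R y) \<le> (1 - t) * h x + t * h y"
    proof (rule field_le_epsilon)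
      fix \<delta> :: real assume "\<delta> > 0"
      then obtain p p' where p: "p \<in> C" "k x p < h x + \<delta>" "p' \<in> C" "k y p' < h y + \<delta>"
        using approx by blast
      have "h ((1 - t) *\<^sub>R x + t *\<^sub>R y) \<le> k ((1 - t) *\<^sub>R x + t *\<^sub>R y) ((1 - t) *\<^sub>R p + t *\<^sub>R p')"
        using p t by (intro h_le mix) auto
      also have "\<dots> \<le> (1 - t) * k x p + t * k y p'"
        using t by (intro k_convex) auto
      also have "\<dots> \<le> (1 - t) * (h x + \<delta>) + t * (h y + \<delta>)"
        using p t by (intro add_mono mult_left_mono) auto
      finally show "h ((1 - t) *\<^sub>R x + t *\<^sub>R y) \<le> (1 - t) * h x + t * h y + \<delta>"
        by (simp add: algebra_simps)
    qed
    then show "h ((1 - t) *\<^sub>R x + t *\<^sub>R y) - h 0 \<le> (1 - t) * (h x - h 0) + t * (h y - h 0)"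
      by (simp add: algebra_simps)
  qed simp
  from convex_function_dominates_linear[OF this] obtain y
    where y: "linear y" "\<And>d. y d \<le> h d - h 0" by auto
  define K where "K = snd p0 + (norm (fst p0) + 1)\<^sup>2 / 2 - e"
  have unit: "y d \<le> K" if "norm d = 1" for d
  proof -
    have "(norm (fst p0 - d))\<^sup>2 \<le> (norm (fst p0) + 1)\<^sup>2"
      using norm_triangle_ineq4[of "fst p0" d] that by (intro power_mono) auto
    then show ?thesis using y(2)[of d] h_le[OF p0, of d] h0 unfolding K_def k_def by linarith
  qed
  have upper: "y d \<le> norm d * K" for d
  proof (cases "d = 0")
    case True
    then show ?thesis using linear_0[OF y(1)] by simp
  next
    case False
    have "y ((1 / norm d) *\<^sub>R d) \<le> K" by (rule unit) (use False in simp)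
    then show ?thesis using False by (simp add: linear_scale[OF y(1)] field_simps)
  qed
  have "bounded_linear y"
  proof (rule bounded_linear_intro)
    show "norm (y d) \<le> norm d * K" for d
      using upper[of d] upper[of "- d"] linear_neg[OF y(1), of d] by (simp add: abs_le_iff)
  qed (auto simp: linear_add[OF y(1)] linear_scale[OF y(1)])
  moreover have "e + y u - y c \<le> r + (norm c)\<^sup>2 / 2" if "(u, r) \<in> C" for u r c
    using y(2)[of "u - c"] h_le[OF that, of "u - c"] h0 linear_diff[OF y(1), of u c]
    by (simp add: k_def)
  ultimately show thesis using that by blast
qed

text \<open>
  The conjugate of half the squared norm is half the squared dual norm. The bound on \<open>f x\<close> comes
  from minimising the left-hand side of the hypothesis over the multiples of \<open>x\<close>.
\<close>

lemma lower_bound_of_half_square_plus_functional: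
  fixes f :: "'v::real_normed_vector dual"
  assumes bound: "\<And>x. m \<le> (norm x)\<^sup>2 / 2 + blinfun_apply f x"
  shows "m \<le> - (norm f)\<^sup>2 / 2"
proof -
  have m: "m \<le> 0" using bound[of 0] by simp
  have "norm f \<le> sqrt (- 2 * m)"
  proof (rule norm_blinfun_bound)
    fix x :: 'v
    show "norm (blinfun_apply f x) \<le> sqrt (- 2 * m) * norm x"
    proof (cases "x = 0")
      case False
      define t where "t = - blinfun_apply f x / (norm x)\<^sup>2"
      have "m \<le> t\<^sup>2 * (norm x)\<^sup>2 / 2 + t * blinfun_apply f x"
        using bound[of "t *\<^sub>R x"] by (simp add: blinfun.scaleR_right power_mult_distrib)
      also have "\<dots> = - (blinfun_apply f x)\<^sup>2 / (2 * (norm x)\<^sup>2)"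
        using False by (simp add: t_def field_simps power2_eq_square)
      finally have "(blinfun_apply f x)\<^sup>2 \<le> - 2 * m * (norm x)\<^sup>2"
        using False by (simp add: field_simps)
      then have "sqrt ((blinfun_apply f x)\<^sup>2) \<le> sqrt (- 2 * m * (norm x)\<^sup>2)"
        by (rule real_sqrt_le_mono)
      also have "\<dots> = sqrt (- 2 * m) * norm x"
        by (simp only: real_sqrt_mult real_sqrt_abs abs_norm_cancel)
      finally show ?thesis by (simp only: real_sqrt_abs real_norm_def)
    qed simp
  qed (use m in simp)
  then have "(norm f)\<^sup>2 \<le> (sqrt (- 2 * m))\<^sup>2" by (intro power_mono) auto
  then show ?thesis using m by simp
qed

section \<open>The quadratic form of the duality pairing\<close>

definition pairing :: "'a::real_normed_vector \<times> 'a dual \<Rightarrow> real" where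
  "pairing b = blinfun_apply (snd b) (fst b)"

text \<open>
  The symmetric bilinear form of which \<open>pairing\<close> is half the associated quadratic form.
\<close>

definition cross :: "'a::real_normed_vector \<times> 'a dual \<Rightarrow> 'a \<times> 'a dual \<Rightarrow> real" where
  "cross b c = blinfun_apply (snd b) (fst c) + blinfun_apply (snd c) (fst b)"

lemma pairing_add: "pairing (b + c) = pairing b + pairing c + cross b c"
  by (simp add: pairing_def cross_def blinfun.bilinear_simps)

lemma pairing_diff: "pairing (b - c) = pairing b + pairing c - cross b c"
  by (simp add: pairing_def cross_def blinfun.bilinear_simps)

lemma pairing_convex_combination:
  "pairing ((1 - t) *\<^sub>R b + t *\<^sub>R c) = (1 - t) * pairing b + t * pairing c - t * (1 - t) * pairing (b - c)"
  by (simp add: pairing_def blinfun.bilinear_simps algebra_simps)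

lemma norm_prod_power2: "(norm b)\<^sup>2 = (norm (fst b))\<^sup>2 + (norm (snd b))\<^sup>2"
  by (simp add: norm_prod_def)

lemma abs_pairing_le: "\<bar>pairing b\<bar> \<le> (norm b)\<^sup>2 / 2"
proof -
  have "\<bar>pairing b\<bar> \<le> norm (snd b) * norm (fst b)"
    using norm_blinfun[of "snd b" "fst b"] by (simp add: pairing_def)
  also have "\<dots> \<le> (norm b)\<^sup>2 / 2"
    using sum_squares_bound[of "norm (snd b)" "norm (fst b)"]
    unfolding norm_prod_power2 by simp
  finally show ?thesis .
qed

lemma abs_cross_le: "\<bar>cross b c\<bar> \<le> 2 * norm b * norm c"
proof -
  have "\<bar>blinfun_apply (snd u) (fst v)\<bar> \<le> norm u * norm v" for u v :: "'a \<times> 'a dual"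
  proof -
    have "\<bar>blinfun_apply (snd u) (fst v)\<bar> \<le> norm (snd u) * norm (fst v)"
      using norm_blinfun[of "snd u" "fst v"] by simp
    also have "\<dots> \<le> norm u * norm v"
      by (intro mult_mono) (auto intro: norm_fst_le norm_snd_le simp: norm_prod_def real_le_rsqrt)
    finally show ?thesis .
  qed
  from this[of b c] this[of c b] show ?thesis
    unfolding cross_def mult.commute[of "norm c" "norm b"] by linarith
qed

section \<open>Enlargements of a maximally monotone set\<close>

text \<open>
  The \<open>\<epsilon>\<close>-enlargement of Burachik and Svaiter, equivalently the set where the Fitzpatrick function
  of \<open>G\<close> is at most \<open>pairing + \<epsilon>\<close>. It is invariant under translation, which lets approximation
  results be proved with an arbitrary centre.
\<close>

definition enlargement ::
  "('a::real_normed_vector \<times> 'a dual) set \<Rightarrow> real \<Rightarrow> ('a \<times> 'a dual) set" where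
  "enlargement G \<epsilon> = {b. \<forall>a\<in>G. - \<epsilon> \<le> pairing (b - a)}"

lemma enlargement_mono: "\<epsilon> \<le> \<delta> \<Longrightarrow> enlargement G \<epsilon> \<subseteq> enlargement G \<delta>"
  by (force simp: enlargement_def)

lemma monotone_set_iff_subset_enlargement: "monotone_set G \<longleftrightarrow> G \<subseteq> enlargement G 0"
  by (fastforce simp: monotone_set_def enlargement_def pairing_def)

text \<open>
  The elements of \<open>enlargement G 0\<close> are the pairs monotonically related to \<open>G\<close>, and
  each of them can be added to a monotone \<open>G\<close> without loss of monotonicity. The equation is the form
  of maximality used below.
\<close>

lemma maximally_monotone_set_iff:
  "maximally_monotone_set G \<longleftrightarrow> enlargement G 0 = G"
proof
  assume G: "maximally_monotone_set G"
  then have mono: "monotone_set G" by (simp add: maximally_monotone_set_def)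
  have "b \<in> G" if b: "b \<in> enlargement G 0" for b
  proof -
    have "pairing (a - b) = pairing (b - a)" for a
      by (simp add: pairing_def blinfun.bilinear_simps)
    moreover have "pairing (b - b) = 0" by (simp add: pairing_def)
    ultimately have "insert b G \<subseteq> enlargement (insert b G) 0"
      using b mono unfolding monotone_set_iff_subset_enlargement enlargement_def
      by (simp add: subset_iff del: split_paired_All)
    then have "insert b G = G"
      using G unfolding maximally_monotone_set_def monotone_set_iff_subset_enlargement
      by (metis subset_insertI)
    then show ?thesis by blast
  qed
  then show "enlargement G 0 = G"
    using mono unfolding monotone_set_iff_subset_enlargement by blast
next
  assume G: "enlargement G 0 = G"
  have "B = G" if "monotone_set B" "G \<subseteq> B" for B
  proof -
    have "B \<subseteq> enlargement B 0"
      using that(1) by (simp add: monotone_set_iff_subset_enlargement)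
    also have "\<dots> \<subseteq> enlargement G 0" using that(2) unfolding enlargement_def by blast
    finally show ?thesis using that(2) G by blast
  qed
  then show "maximally_monotone_set G"
    using G unfolding maximally_monotone_set_def
    by (metis monotone_set_iff_subset_enlargement subset_refl)
qed

text \<open>
  This is the inequality between the Fitzpatrick function and the pairing: a negative \<open>\<epsilon>\<close> would put
  \<open>b\<close> into \<open>G\<close>, but \<open>b\<close> pairs with itself to \<open>0\<close>.
\<close>

lemma enlargement_nonneg:
  assumes G: "enlargement G 0 = G" and b: "b \<in> enlargement G \<epsilon>"
  shows "0 \<le> \<epsilon>"
proof (rule ccontr)
  assume "\<not> 0 \<le> \<epsilon>"
  then have "b \<in> G" using enlargement_mono[of \<epsilon> 0 G] b G by auto
  then have "- \<epsilon> \<le> pairing (b - b)" using b by (auto simp: enlargement_def)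
  then show False using \<open>\<not> 0 \<le> \<epsilon>\<close> by (simp add: pairing_def)
qed

text \<open>
  The midpoint of \<open>b\<close> and \<open>c\<close> lies in the enlargement by
  \<open>\<epsilon> / 2 + \<delta> / 2 + pairing (b - c) / 4\<close>, and this number cannot be negative. Together with an upper
  bound on \<open>\<parallel>b - c\<parallel>\<^sup>2 / 2 + pairing (b - c)\<close>, the estimate controls the distance of \<open>b\<close> and \<open>c\<close>.
\<close>

lemma enlargement_pairing_lower:
  assumes G: "enlargement G 0 = G" and b: "b \<in> enlargement G \<epsilon>" and c: "c \<in> enlargement G \<delta>"
  shows "- pairing (b - c) \<le> 2 * \<epsilon> + 2 * \<delta>"
proof -
  let ?m = "(1 - 1/2) *\<^sub>R b + (1/2) *\<^sub>R c"
  have "- (\<epsilon> / 2 + \<delta> / 2 + pairing (b - c) / 4) \<le> pairing (?m - a)" if "a \<in> G" for a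
  proof -
    have "?m - a = (1 - 1/2) *\<^sub>R (b - a) + (1/2) *\<^sub>R (c - a)"
      by (simp add: algebra_simps flip: scaleR_left.add)
    then have "pairing (?m - a) = pairing (b - a) / 2 + pairing (c - a) / 2 - pairing (b - c) / 4"
      by (simp only: pairing_convex_combination) simp
    moreover have "- \<epsilon> \<le> pairing (b - a)" "- \<delta> \<le> pairing (c - a)"
      using that b c by (auto simp: enlargement_def)
    ultimately show ?thesis by simp
  qed
  then have "?m \<in> enlargement G (\<epsilon> / 2 + \<delta> / 2 + pairing (b - c) / 4)"
    by (simp add: enlargement_def)
  from enlargement_nonneg[OF G this] show ?thesis by simp
qed

text \<open>
  Fenchel duality is applied to \<open>C\<close>, the epigraph of the Fitzpatrick function after moving \<open>c\<close>
  to the origin. If the assertion failed, the resulting functional, split into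
  \<open>y'\<close> on the space and \<open>y''\<close> on its dual, could be tested at the point \<open>(s, c' + y')\<close> of \<open>G\<close>,
  where \<open>c'\<close> is the second coordinate of \<open>c\<close>; there all terms involving \<open>s\<close> cancel and
  \<open>\<epsilon> \<le> - y'' y' - \<parallel>y'\<parallel>\<^sup>2 / 2 - \<parallel>y''\<parallel>\<^sup>2 / 2 \<le> 0\<close> remains.
\<close>

lemma enlargement_approximation:
  fixes G :: "('a::real_normed_vector \<times> 'a dual) set"
  assumes G: "enlargement G 0 = G" and surj: "snd ` G = UNIV" and "0 < \<epsilon>"
  obtains b where "b \<in> enlargement G \<epsilon>" "(norm (b - c))\<^sup>2 / 2 + pairing (b - c) < \<epsilon>"
proof -
  define C where "C = {(u, r). u + c \<in> enlargement G (r - pairing u)}"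
  \<comment> \<open>The quadratic terms in \<open>u\<close> cancel, so \<open>C\<close> is an intersection of half-spaces.\<close>
  have C_iff: "(u, r) \<in> C \<longleftrightarrow> (\<forall>a\<in>G. cross u (a - c) - pairing (a - c) \<le> r)" for u r
  proof -
    have eq: "pairing (u + c - a) = pairing u + pairing (a - c) - cross u (a - c)" for a
      using pairing_diff[of u "a - c"] by (simp add: algebra_simps)
    have "- (r - pairing u) \<le> pairing (u + c - a) \<longleftrightarrow> cross u (a - c) - pairing (a - c) \<le> r" for a
      unfolding eq by linarith
    then show ?thesis by (simp only: C_def enlargement_def mem_Collect_eq prod.case)
  qed
  have "\<exists>u r. (u, r) \<in> C \<and> r + (norm u)\<^sup>2 / 2 < \<epsilon>"
  proof (rule ccontr)
    assume "\<not> ?thesis"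
    then have lower: "\<epsilon> \<le> r + (norm u)\<^sup>2 / 2" if "(u, r) \<in> C" for u r
      using that by (meson not_le)
    have graph_C: "(a - c, pairing (a - c)) \<in> C" if "a \<in> G" for a
      using that G by (simp add: C_def)
    have "C \<noteq> {}" using graph_C surj by blast
    have "convex C"
    proof -
      have cross_lin: "cross (s *\<^sub>R u + t *\<^sub>R v) k = s * cross u k + t * cross v k" for s t u v and k :: "'a \<times> 'a dual"
        by (simp add: cross_def blinfun.bilinear_simps algebra_simps)
      have "s * cross u k + t * cross v k - p \<le> s * r + t * r'"
        if "0 \<le> s" "0 \<le> t" "s + t = 1" "cross u k - p \<le> r" "cross v k - p \<le> r'"
        for s t r r' p :: real and u v k :: "'a \<times> 'a dual"
      proof -
        have "s * (cross u k - p) + t * (cross v k - p) \<le> s * r + t * r'"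
          using that by (intro add_mono mult_left_mono) auto
        moreover have "s * p + t * p = p" using that by (simp flip: distrib_right)
        ultimately show ?thesis by (simp add: algebra_simps)
      qed
      note combination = this
      show ?thesis
      proof (rule convexI)
        fix p q s t assume pq: "p \<in> C" "q \<in> C" and st: "0 \<le> (s::real)" "0 \<le> t" "s + t = 1"
        obtain u r v r' where "p = (u, r)" "q = (v, r')" by (metis prod.collapse)
        then show "s *\<^sub>R p + t *\<^sub>R q \<in> C"
          using pq combination[OF st] by (simp add: C_iff cross_lin)
      qed
    qed
    from fenchel_duality_half_square_norm[OF this \<open>C \<noteq> {}\<close> lower]
    obtain y where y: "bounded_linear y"
      and dual: "\<And>u r d. (u, r) \<in> C \<Longrightarrow> \<epsilon> + y u - y d \<le> r + (norm d)\<^sup>2 / 2" by blast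
    interpret y: bounded_linear y by (rule y)
    define y' where "y' = Blinfun (\<lambda>x. y (x, 0))"
    define y'' where "y'' = Blinfun (\<lambda>x'. y (0, x'))"
    have "bounded_linear (\<lambda>x. y (x, 0))" "bounded_linear (\<lambda>x'. y (0, x'))"
      by (rule bounded_linear_compose[OF y], intro bounded_linear_intros)+
    then have y'_apply: "blinfun_apply y' x = y (x, 0)" and y''_apply: "blinfun_apply y'' x' = y (0, x')"
      for x x' by (simp_all add: y'_def y''_def bounded_linear_Blinfun_apply)
    have y_split: "y (x, x') = blinfun_apply y' x + blinfun_apply y'' x'" for x x'
      using y.add[of "(x, 0)" "(0, x')"] by (simp add: y'_apply y''_apply)
    obtain s where s: "(s, snd c + y') \<in> G"
      using surj by (metis UNIV_I imageE prod.collapse)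
    have "\<epsilon> + blinfun_apply y'' y' \<le> ((norm x)\<^sup>2 / 2 + blinfun_apply y' x)
        + ((norm x')\<^sup>2 / 2 + blinfun_apply y'' x')" for x x'
    proof -
      have u: "(s, snd c + y') - c = (s - fst c, y')" by (simp add: prod_eq_iff)
      have "\<epsilon> + y (s - fst c, y') - y (x, x') \<le> blinfun_apply y' (s - fst c) + (norm (x, x'))\<^sup>2 / 2"
        using dual[OF graph_C[OF s], of "(x, x')"] unfolding u
        by (simp add: pairing_def)
      then show ?thesis by (simp add: y_split norm_prod_power2)
    qed
    then have "\<epsilon> + blinfun_apply y'' y' - ((norm x')\<^sup>2 / 2 + blinfun_apply y'' x') \<le> - (norm y')\<^sup>2 / 2" for x'
      by (intro lower_bound_of_half_square_plus_functional) (simp add: algebra_simps)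
    then have "\<epsilon> + blinfun_apply y'' y' + (norm y')\<^sup>2 / 2 \<le> - (norm y'')\<^sup>2 / 2"
      by (intro lower_bound_of_half_square_plus_functional) (simp add: algebra_simps)
    moreover have "- blinfun_apply y'' y' \<le> (norm (y', y''))\<^sup>2 / 2"
      using abs_pairing_le[of "(y', y'')"] by (simp add: pairing_def)
    ultimately show False using \<open>0 < \<epsilon>\<close> by (simp add: norm_prod_power2)
  qed
  then obtain u r where u: "u + c \<in> enlargement G (r - pairing u)" "r + (norm u)\<^sup>2 / 2 < \<epsilon>"
    by (auto simp: C_def)
  \<comment> \<open>Both \<open>r - pairing u\<close> and \<open>\<parallel>u\<parallel>\<^sup>2 / 2 + pairing u\<close> are nonnegative, so each is below the bound
    on their sum.\<close>
  show thesis
  proof (rule that[of "u + c"])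
    have "0 \<le> (norm u)\<^sup>2 / 2 + pairing u" using abs_pairing_le[of u] by simp
    then show "u + c \<in> enlargement G \<epsilon>" using u enlargement_mono[of "r - pairing u" \<epsilon> G] by auto
    show "(norm (u + c - c))\<^sup>2 / 2 + pairing (u + c - c) < \<epsilon>"
      using u enlargement_nonneg[OF G u(1)] by simp
  qed
qed

text \<open>
  A theorem of Bronsted-Rockafellar type. Starting from \<open>b0\<close>, each new point approximates the
  previous one in the sense of \<open>enlargement_approximation\<close> with error \<open>\<delta>\<^sup>2 / 4 ^ n\<close>. By
  \<open>enlargement_pairing_lower\<close> the square of the step is at most a multiple of the error, so the
  steps decrease like \<open>\<delta> / 2 ^ n\<close> and the sequence converges to a point monotonically related
  to \<open>G\<close>.
\<close>

lemma enlargement_near_graph: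
  fixes G :: "('a::banach \<times> 'a dual) set"
  assumes G: "enlargement G 0 = G" and surj: "snd ` G = UNIV"
    and "0 < \<delta>" and b0: "b0 \<in> enlargement G (\<delta>\<^sup>2)"
  obtains b where "b \<in> G" "norm (b - b0) \<le> 8 * \<delta>"
proof -
  define e where "e n = \<delta>\<^sup>2 / 4 ^ n" for n :: nat
  have e_pos: "0 < e n" for n using \<open>0 < \<delta>\<close> by (simp add: e_def)
  have "\<exists>f. \<forall>n. (f n \<in> enlargement G (e n) \<and> (n = 0 \<longrightarrow> f n = b0))
      \<and> norm (f (Suc n) - f n) \<le> 4 * \<delta> * (1/2) ^ n"
  proof (rule dependent_nat_choice)
    show "\<exists>x. x \<in> enlargement G (e 0) \<and> (0 = 0 \<longrightarrow> x = b0)"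
      using b0 by (intro exI[of _ b0]) (simp add: e_def)
  next
    fix x and n :: nat
    assume x: "x \<in> enlargement G (e n) \<and> (n = 0 \<longrightarrow> x = b0)"
    obtain z where z: "z \<in> enlargement G (e (Suc n))"
      "(norm (z - x))\<^sup>2 / 2 + pairing (z - x) < e (Suc n)"
      using enlargement_approximation[OF G surj e_pos] by blast
    have "- pairing (z - x) \<le> 2 * e (Suc n) + 2 * e n"
      using enlargement_pairing_lower[OF G z(1)] x by blast
    \<comment> \<open>The two estimates give the factor \<open>2 (3 / 4 + 2) \<le> 16\<close>; a perfect square is convenient.\<close>
    then have "(norm (z - x))\<^sup>2 \<le> 16 * e n"
      using z(2) e_pos[of n] by (simp add: e_def)
    also have "\<dots> = (4 * \<delta> * (1/2) ^ n)\<^sup>2"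
    proof -
      have "((1/2 :: real) ^ n)\<^sup>2 = ((1/2)\<^sup>2) ^ n" by (simp only: mult.commute flip: power_mult)
      then show ?thesis by (simp add: e_def power_mult_distrib power_divide)
    qed
    finally have "norm (z - x) \<le> 4 * \<delta> * (1/2) ^ n"
      by (rule power2_le_imp_le) (use \<open>0 < \<delta>\<close> in simp)
    then show "\<exists>y. (y \<in> enlargement G (e (Suc n)) \<and> (Suc n = 0 \<longrightarrow> y = b0))
        \<and> norm (y - x) \<le> 4 * \<delta> * (1/2) ^ n"
      using z(1) by blast
  qed
  then obtain f where f: "\<And>n. f n \<in> enlargement G (e n)" "f 0 = b0"
    and step: "\<And>n. norm (f (Suc n) - f n) \<le> 4 * \<delta> * (1/2) ^ n" by blast
  define l where "l = (\<Sum>n. f (Suc n) - f n)"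
  have sums: "(\<lambda>n. 4 * \<delta> * (1/2) ^ n) sums (4 * \<delta> * 2)"
    using sums_mult[OF geometric_sums[of "1/2 :: real"], of "4 * \<delta>"] by simp
  have "summable (\<lambda>n. f (Suc n) - f n)"
    by (rule summable_comparison_test'[OF sums_summable[OF sums], of 0]) (rule step)
  then have "(\<lambda>n. \<Sum>i<n. f (Suc i) - f i) \<longlonglongrightarrow> l"
    unfolding l_def by (rule summable_LIMSEQ)
  then have "(\<lambda>n. f n - b0) \<longlonglongrightarrow> l" by (simp add: sum_lessThan_telescope f)
  then have lim: "f \<longlonglongrightarrow> b0 + l" using tendsto_add[of "\<lambda>_. b0" b0 sequentially "\<lambda>n. f n - b0" l] by simp
  have "e \<longlonglongrightarrow> 0"
    unfolding e_def using LIMSEQ_divide_realpow_zero[of 4 "\<delta>\<^sup>2"] by simp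
  have "b0 + l \<in> enlargement G 0"
  proof -
    have "0 \<le> pairing (b0 + l - a)" if "a \<in> G" for a
    proof (rule LIMSEQ_le)
      show "(\<lambda>n. pairing (f n - a)) \<longlonglongrightarrow> pairing (b0 + l - a)"
        unfolding pairing_def by (intro tendsto_intros lim)
      show "(\<lambda>n. - e n) \<longlonglongrightarrow> 0" using tendsto_minus[OF \<open>e \<longlonglongrightarrow> 0\<close>] by simp
      show "\<exists>N. \<forall>n\<ge>N. - e n \<le> pairing (f n - a)"
        using f(1) that by (auto simp: enlargement_def)
    qed
    then show ?thesis by (simp add: enlargement_def)
  qed
  moreover have "norm l \<le> 8 * \<delta>"
    using norm_suminf_le[OF step sums_summable[OF sums]] sums_unique[OF sums] by (simp add: l_def)
  ultimately show thesis using that[of "b0 + l"] G by simp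
qed

section \<open>Quasidensity of surjective maximally monotone multifunctions\<close>

text \<open>
  An approximation \<open>b\<close> of \<open>c\<close> in the \<open>\<delta>\<^sup>2\<close>-enlargement is replaced by a point \<open>z\<close> of \<open>G\<close> at
  distance at most \<open>8 \<delta>\<close>. The error of this replacement is of order \<open>\<delta>\<close> because \<open>b\<close> stays in a
  ball around \<open>c\<close> whose radius \<open>M\<close> does not depend on \<open>\<delta>\<close>.
\<close>

lemma surjective_maximal_graph_approximation:
  fixes G :: "('a::banach \<times> 'a dual) set"
  assumes G: "enlargement G 0 = G" and surj: "snd ` G = UNIV" and "0 < \<eta>"
  obtains b where "b \<in> G" "(norm (b - c))\<^sup>2 / 2 + pairing (b - c) \<le> \<eta>"
proof -
  obtain a where a: "a \<in> G" using surj by blast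
  define M where "M = 5 * norm (a - c) + 2"
  define \<delta> where "\<delta> = min 1 (\<eta> / (65 + 24 * M))"
  have "M > 0" unfolding M_def using norm_ge_zero[of "a - c"] by linarith
  have "\<delta> \<le> \<eta> / (65 + 24 * M)" by (simp add: \<delta>_def)
  then have \<delta>: "0 < \<delta>" "\<delta> \<le> 1" "\<delta> * (65 + 24 * M) \<le> \<eta>"
    using \<open>0 < \<eta>\<close> \<open>M > 0\<close> by (simp add: \<delta>_def, simp add: \<delta>_def, simp add: pos_le_divide_eq)
  then have \<delta>2: "\<delta>\<^sup>2 \<le> \<delta>" by (simp add: power2_eq_square)
  obtain b where b: "b \<in> enlargement G (\<delta>\<^sup>2)" "(norm (b - c))\<^sup>2 / 2 + pairing (b - c) < \<delta>\<^sup>2"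
    using enlargement_approximation[OF G surj, of "\<delta>\<^sup>2" c] \<delta> by auto
  let ?D = "norm (b - c)" and ?K = "norm (a - c)"
  \<comment> \<open>Membership of \<open>b\<close> in the enlargement, tested at the fixed point \<open>a\<close> of \<open>G\<close>, bounds
    \<open>- pairing (b - c)\<close> by an affine function of \<open>?D\<close>, whereas \<open>?D\<^sup>2 / 2\<close> exceeds
    \<open>- pairing (b - c)\<close> by less than \<open>1\<close>.\<close>
  have D: "?D \<le> M"
  proof -
    have "- (\<delta>\<^sup>2) \<le> pairing ((b - c) - (a - c))" using b(1) a by (simp add: enlargement_def)
    then have "- pairing (b - c) \<le> 1 + ?K\<^sup>2 / 2 + 2 * ?D * ?K"
      using \<delta> \<delta>2 abs_pairing_le[of "a - c"] abs_cross_le[of "b - c" "a - c"]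
      unfolding pairing_diff[of "b - c" "a - c"] by linarith
    then have "?D\<^sup>2 \<le> 4 + ?K\<^sup>2 + 4 * ?D * ?K"
      using b(2) \<delta> \<delta>2 by linarith
    then have "(?D - 2 * ?K)\<^sup>2 \<le> (3 * ?K + 2)\<^sup>2"
      by (simp add: power2_eq_square algebra_simps)
        (use zero_le_square[of ?K] norm_ge_zero[of "a - c"] in linarith)
    then have "?D - 2 * ?K \<le> 3 * ?K + 2" by (rule power2_le_imp_le) simp
    then show ?thesis by (simp add: M_def)
  qed
  obtain z where z: "z \<in> G" "norm (z - b) \<le> 8 * \<delta>"
    using enlargement_near_graph[OF G surj \<delta>(1) b(1)] by blast
  let ?E = "norm (z - b)"
  have zc: "z - c = (b - c) + (z - b)" by simp
  have "(norm (z - c))\<^sup>2 \<le> (?D + ?E)\<^sup>2"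
    unfolding zc by (intro power_mono norm_triangle_ineq) simp
  then have "(norm (z - c))\<^sup>2 / 2 \<le> ?D\<^sup>2 / 2 + ?D * ?E + ?E\<^sup>2 / 2"
    by (simp add: power2_eq_square algebra_simps)
  moreover have "pairing (z - c) \<le> pairing (b - c) + ?E\<^sup>2 / 2 + 2 * ?D * ?E"
    using abs_pairing_le[of "z - b"] abs_cross_le[of "b - c" "z - b"]
    unfolding zc pairing_add by linarith
  moreover have "?D * ?E \<le> M * (8 * \<delta>)" using D z(2) \<open>M > 0\<close> by (intro mult_mono) auto
  moreover have "?E\<^sup>2 \<le> 64 * \<delta>"
    using power_mono[OF z(2), of 2] \<delta>2 by (simp add: power_mult_distrib)
  ultimately have "(norm (z - c))\<^sup>2 / 2 + pairing (z - c) \<le> \<delta> + 24 * (M * \<delta>) + 64 * \<delta>"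
    using b(2) \<delta>2 by linarith
  also have "\<dots> \<le> \<eta>" using \<delta>(3) by (simp add: algebra_simps)
  finally show thesis using that z(1) by blast
qed

lemma quasidense_of_surjective:
  fixes S :: "'a::banach \<Rightarrow> 'a dual set"
  assumes max: "maximally_monotone S" and surj: "mf_range S = UNIV"
  shows "quasidense S"
  unfolding quasidense_def
proof (intro allI)
  fix x :: 'a and x' :: "'a dual"
  have G: "enlargement (mf_graph S) 0 = mf_graph S"
    using max by (simp add: maximally_monotone_def maximally_monotone_set_iff)
  have surj': "snd ` mf_graph S = UNIV"
    using surj by (force simp: mf_range_def mf_graph_def image_iff)
  show "(INF (s, s') \<in> mf_graph S.
        ereal ((norm (s - x))\<^sup>2 / 2 + (norm (s' - x'))\<^sup>2 / 2
               + blinfun_apply (s' - x') (s - x))) \<le> 0" (is "?I \<le> 0")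
  proof (rule ereal_le_epsilon2)
    fix \<eta> :: real assume "0 < \<eta>"
    then obtain s s' where s: "(s, s') \<in> mf_graph S"
      and le: "(norm ((s, s') - (x, x')))\<^sup>2 / 2 + pairing ((s, s') - (x, x')) \<le> \<eta>"
      using surjective_maximal_graph_approximation[OF G surj', of \<eta> "(x, x')"] by (metis prod.collapse)
    have "?I \<le> ereal ((norm (s - x))\<^sup>2 / 2 + (norm (s' - x'))\<^sup>2 / 2
               + blinfun_apply (s' - x') (s - x))"
      by (rule INF_lower2[OF s]) simp
    also have "\<dots> \<le> 0 + ereal \<eta>"
      using le by (simp add: norm_prod_power2 pairing_def add_divide_distrib)
    finally show "?I \<le> 0 + ereal \<eta>" .
  qed
qed

section \<open>The conjugate of the Fitzpatrick function\<close>

lemma fitzpatrick_le_pairing: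
  assumes "monotone_set (mf_graph S)" "(x, x') \<in> mf_graph S"
  shows "fitzpatrick S (x, x') \<le> ereal (blinfun_apply x' x)"
  unfolding fitzpatrick_def prod.case
proof (rule SUP_least, clarify)
  fix s s' assume "(s, s') \<in> mf_graph S"
  then have "0 \<le> blinfun_apply (s' - x') (s - x)"
    using assms by (auto simp: monotone_set_def)
  then show "ereal (blinfun_apply x' s + blinfun_apply s' x - blinfun_apply s' s)
      \<le> ereal (blinfun_apply x' x)"
    by (simp add: blinfun.bilinear_simps)
qed

text \<open>
  These are the values at points of the graph of the expression whose supremum is the conjugate, with
  the Fitzpatrick function bounded by the pairing. The left-hand side minus \<open>y'' y'\<close> is
  \<open>- pairing ((y', y'') - L_map (s, s'))\<close>, so if the conjugate equals the pairing, then
  \<open>(y', y'')\<close> is monotonically related to the image of the graph under \<open>L\<close>.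
\<close>

lemma le_fitzpatrick_conj:
  assumes "monotone_set (mf_graph S)" "(s, s') \<in> mf_graph S"
  shows "ereal (blinfun_apply y' s + blinfun_apply y'' s' - blinfun_apply s' s)
    \<le> fitzpatrick_conj S (y', y'')"
proof -
  have "ereal (blinfun_apply y' s + blinfun_apply y'' s' - blinfun_apply s' s)
      = ereal (blinfun_apply y' s + blinfun_apply y'' s') - ereal (blinfun_apply s' s)"
    by simp
  also have "\<dots> \<le> ereal (blinfun_apply y' s + blinfun_apply y'' s') - fitzpatrick S (s, s')"
    by (intro ereal_minus_mono order_refl fitzpatrick_le_pairing assms)
  also have "\<dots> \<le> fitzpatrick_conj S (y', y'')"
    unfolding fitzpatrick_conj_def prod.case by (rule SUP_upper2[of "(s, s')"]) auto
  finally show ?thesis .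
qed

text \<open>
  For the upper bound, the single term of the supremum defining the Fitzpatrick function that belongs
  to \<open>(x, x')\<close> is an affine minorant of it, and conjugating this minorant gives the pairing.
\<close>

lemma fitzpatrick_conj_canon:
  assumes mono: "monotone_set (mf_graph S)" and x: "(x, x') \<in> mf_graph S"
  shows "fitzpatrick_conj S (x', canon x) = ereal (blinfun_apply x' x)"
proof (rule antisym)
  show "ereal (blinfun_apply x' x) \<le> fitzpatrick_conj S (x', canon x)"
    using le_fitzpatrick_conj[OF mono x, of x' "canon x"] by simp
  show "fitzpatrick_conj S (x', canon x) \<le> ereal (blinfun_apply x' x)"
    unfolding fitzpatrick_conj_def prod.case
  proof (rule SUP_least, clarify)
    fix z :: 'a and z' :: "'a dual"
    have "ereal (blinfun_apply z' x + blinfun_apply x' z - blinfun_apply x' x) \<le> fitzpatrick S (z, z')"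
      unfolding fitzpatrick_def prod.case by (rule SUP_upper2[OF x]) simp
    then have "ereal (blinfun_apply x' z + blinfun_apply (canon x) z') - fitzpatrick S (z, z')
        \<le> ereal (blinfun_apply x' z + blinfun_apply (canon x) z')
          - ereal (blinfun_apply z' x + blinfun_apply x' z - blinfun_apply x' x)"
      by (intro ereal_minus_mono order_refl)
    also have "\<dots> = ereal (blinfun_apply x' x)" by simp
    finally show "ereal (blinfun_apply x' z + blinfun_apply (canon x) z') - fitzpatrick S (z, z')
        \<le> ereal (blinfun_apply x' x)" .
  qed
qed

section \<open>Transfer along the canonical embedding\<close>

lemma pairing_L_map_diff: "pairing (L_map b - L_map a) = pairing (b - a)"
  by (simp add: pairing_def L_map_def blinfun.bilinear_simps split: prod.split)

text \<open>
  With \<open>\<epsilon> = 0\<close> this transfers maximal monotonicity from a subset of the range of \<open>L\<close> to its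
  preimage.
\<close>

lemma enlargement_vimage_L_map:
  assumes "A \<subseteq> range L_map"
  shows "enlargement (L_map -` A) \<epsilon> = L_map -` enlargement A \<epsilon>"
proof -
  have "(\<forall>a\<in>A. P a) \<longleftrightarrow> (\<forall>a\<in>L_map -` A. P (L_map a))" for P
    using assms by blast
  then show ?thesis
    by (simp add: enlargement_def pairing_L_map_diff set_eq_iff del: split_paired_All)
qed

theorem theorem8p5:
  fixes T :: "'a::banach dual \<Rightarrow> 'a bidual set"
    and S :: "'a \<Rightarrow> 'a dual set"
  assumes nonzero: "\<exists>x::'a. x \<noteq> 0"
    and range_T: "mf_range T \<subseteq> range canon"
    and graph_S: "mf_graph S = L_map -` mf_graph T"
  shows "mf_graph T \<subseteq> L_map ` mf_graph S
    \<and> (maximally_monotone T \<longrightarrow> maximally_monotone S)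
    \<and> (maximally_monotone T \<and> mf_domain T = UNIV \<longrightarrow>
         maximally_monotone S \<and> quasidense S \<and> fitzpatrick_ext S = T)"
proof (intro conjI impI)
  have S_iff: "(x, x') \<in> mf_graph S \<longleftrightarrow> (x', canon x) \<in> mf_graph T" for x x'
    by (simp add: graph_S L_map_def)
  have T_canon: "\<exists>x. y'' = canon x \<and> (x, y') \<in> mf_graph S" if "(y', y'') \<in> mf_graph T" for y' y''
  proof -
    have "y'' \<in> mf_range T" using that by (auto simp: mf_range_def mf_graph_def)
    then show ?thesis using range_T that by (auto simp: S_iff)
  qed
  show part_a: "mf_graph T \<subseteq> L_map ` mf_graph S"
  proof clarify
    fix y' y'' assume "(y', y'') \<in> mf_graph T"
    then obtain x where "y'' = canon x" "(x, y') \<in> mf_graph S" using T_canon by blast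
    then show "(y', y'') \<in> L_map ` mf_graph S" by (force simp: L_map_def image_iff)
  qed
  show part_b: "maximally_monotone S" if "maximally_monotone T"
  proof -
    have "mf_graph T \<subseteq> range L_map" using part_a by blast
    then show ?thesis
      using that by (simp add: maximally_monotone_def maximally_monotone_set_iff graph_S
          enlargement_vimage_L_map)
  qed
  assume T: "maximally_monotone T \<and> mf_domain T = UNIV"
  then show max_S: "maximally_monotone S" using part_b by blast
  have "x' \<in> mf_range S" for x'
  proof -
    obtain y'' where "(x', y'') \<in> mf_graph T"
      using T by (auto simp: mf_domain_def mf_graph_def)
    then show ?thesis using T_canon by (force simp: mf_range_def mf_graph_def)
  qed
  then show "quasidense S" using quasidense_of_surjective[OF max_S] by blast
  have mono_S: "monotone_set (mf_graph S)"
    using max_S by (simp add: maximally_monotone_def maximally_monotone_set_def)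
  have "y'' \<in> fitzpatrick_ext S y' \<longleftrightarrow> y'' \<in> T y'" for y' y''
  proof
    assume "y'' \<in> T y'"
    then obtain x where "y'' = canon x" "(x, y') \<in> mf_graph S"
      using T_canon by (auto simp: mf_graph_def)
    then show "y'' \<in> fitzpatrick_ext S y'"
      using fitzpatrick_conj_canon[OF mono_S] by (simp add: fitzpatrick_ext_def)
  next
    assume "y'' \<in> fitzpatrick_ext S y'"
    then have conj: "fitzpatrick_conj S (y', y'') = ereal (blinfun_apply y'' y')"
      by (simp add: fitzpatrick_ext_def)
    have "0 \<le> pairing ((y', y'') - (s', s''))" if "(s', s'') \<in> mf_graph T" for s' s''
    proof -
      from T_canon[OF that] obtain s where s: "s'' = canon s" "(s, s') \<in> mf_graph S" by blast
      show ?thesis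
        using le_fitzpatrick_conj[OF mono_S s(2), of y' y''] conj
        by (simp add: s(1) pairing_def blinfun.bilinear_simps)
    qed
    then have "(y', y'') \<in> mf_graph T"
      using T by (auto simp: maximally_monotone_def maximally_monotone_set_iff enlargement_def)
    then show "y'' \<in> T y'" by (simp add: mf_graph_def)
  qed
  then show "fitzpatrick_ext S = T" by blast
qed

end
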